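(* Let $\mathbb{F}_q$ be a finite field, let $f\in\mathbb{F}_q[x]$ be a nonzero monic polynomial, and let $D=\{f_1,f_2\}$ be a set of monic divisors of $f$ such that $\gcd(f_1,f_2)=1$. Suppose that the following conditions hold: (1) $\mathbb{F}_q\neq\mathbb{F}_2$; (2) $\omega(f_1)\ge 2$ and $\omega(f_2)\ge 1$. Then the gcd-graph $G_f(D)$ is not perfect.
   Context: All polynomials are monic unless stated otherwise and gcd's are taken monic (so $\gcd(0,f)=f$). The gcd-graph $G_f(D)$ is the undirected graph with vertex set the ring $\mathbb{F}_q[x]/(f)$ in which two vertices $u,v$ are adjacent if and only if $\gcd(u-v,f)\in D$ (here it is loopless, since the hypotheses force $f\notin D$). $\omega(h)$ denotes the number of distinct monic irreducible factors of $h$. A graph is perfect if for every induced subgraph $H$ the chromatic number of $H$ equals the size of its maximum clique. *)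

theory Defs
  imports
    "HOL-Computational_Algebra.Computational_Algebra"
    "Graph_Theory.Graph_Theory"
begin

section \<open>Perfect graphs\<close>

text \<open>
  As in Graph_Theory, an undirected graph is a symmetric digraph. The definitions
  below are meant for finite graphs; for a graph with a loop no proper colouring exists.
\<close>

definition is_clique :: "('v, 'e) pre_digraph \<Rightarrow> 'v set \<Rightarrow> bool" where
  "is_clique G K \<longleftrightarrow> K \<subseteq> verts G \<and> (\<forall>u\<in>K. \<forall>v\<in>K. u \<noteq> v \<longrightarrow> u \<rightarrow>\<^bsub>G\<^esub> v)"

definition clique_number :: "('v, 'e) pre_digraph \<Rightarrow> nat" where
  "clique_number G = Max (card ` {K. is_clique G K})"

definition proper_colouring :: "('v, 'e) pre_digraph \<Rightarrow> nat \<Rightarrow> ('v \<Rightarrow> nat) \<Rightarrow> bool" where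
  "proper_colouring G k c \<longleftrightarrow>
     c ` verts G \<subseteq> {..<k} \<and> (\<forall>u v. u \<rightarrow>\<^bsub>G\<^esub> v \<longrightarrow> c u \<noteq> c v)"

definition chromatic_number :: "('v, 'e) pre_digraph \<Rightarrow> nat" where
  "chromatic_number G = (LEAST k. \<exists>c. proper_colouring G k c)"

definition perfect_graph :: "('v, 'e) pre_digraph \<Rightarrow> bool" where
  "perfect_graph G \<longleftrightarrow>
     (\<forall>H. induced_subgraph H G \<longrightarrow> chromatic_number H = clique_number H)"


section \<open>gcd-graphs over polynomial rings\<close>

definition poly_cong :: "'a :: field_gcd poly \<Rightarrow> 'a poly rel" where
  "poly_cong f = {(u, v). f dvd u - v}"

text \<open>
  The vertices are the residue classes modulo \<open>f\<close>, i.e. the elements of the quotient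
  ring by the ideal generated by \<open>f\<close>. For monic \<open>f\<close> the value of \<open>gcd (u - v) f\<close> is
  monic and does not depend on the representatives; see \<open>gcd_graph_adj_iff\<close>.
\<close>

definition gcd_graph :: "'a :: field_gcd poly \<Rightarrow> 'a poly set \<Rightarrow> 'a poly set pair_pre_digraph" where
  "gcd_graph f D =
     \<lparr> pverts = UNIV // poly_cong f,
       parcs = {(U, V). U \<in> UNIV // poly_cong f \<and> V \<in> UNIV // poly_cong f \<and>
                        (\<exists>u\<in>U. \<exists>v\<in>V. gcd (u - v) f \<in> D)} \<rparr>"

definition omega :: "'a :: field_gcd poly \<Rightarrow> nat" where
  "omega h = card {p. lead_coeff p = 1 \<and> irreducible p \<and> p dvd h}"

lemma equiv_poly_cong: "equiv UNIV (poly_cong f)"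
proof (rule equivI)
  show "sym (poly_cong f)"
    unfolding sym_def poly_cong_def by (simp add: dvd_diff_commute)
  show "trans (poly_cong f)"
  proof (rule transI)
    fix x y z assume "(x, y) \<in> poly_cong f" "(y, z) \<in> poly_cong f"
    then have "f dvd (x - y) + (y - z)"
      unfolding poly_cong_def by (intro dvd_add) auto
    then show "(x, z) \<in> poly_cong f" by (simp add: poly_cong_def)
  qed
qed (auto simp: refl_on_def poly_cong_def)

lemma gcd_diff_poly_cong:
  assumes "(u, u') \<in> poly_cong f" "(v, v') \<in> poly_cong f"
  shows "gcd (u - v) f = gcd (u' - v') f"
proof -
  have "f dvd (u - u') - (v - v')"
    using assms dvd_diff[of f "u - u'" "v - v'"] by (simp add: poly_cong_def)
  then obtain k where "(u - u') - (v - v') = f * k" by (elim dvdE)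
  then have "u - v = k * f + (u' - v')" by (simp add: algebra_simps)
  then show ?thesis by (metis add.commute gcd.commute gcd_add_mult)
qed

lemma gcd_graph_adj_iff:
  "(poly_cong f `` {u}) \<rightarrow>\<^bsub>with_proj (gcd_graph f D)\<^esub> (poly_cong f `` {v}) \<longleftrightarrow> gcd (u - v) f \<in> D"
proof
  assume "(poly_cong f `` {u}) \<rightarrow>\<^bsub>with_proj (gcd_graph f D)\<^esub> (poly_cong f `` {v})"
  then obtain u' v' where "(u, u') \<in> poly_cong f" "(v, v') \<in> poly_cong f" "gcd (u' - v') f \<in> D"
    by (auto simp: gcd_graph_def)
  then show "gcd (u - v) f \<in> D" using gcd_diff_poly_cong by metis
next
  assume "gcd (u - v) f \<in> D"
  moreover have "u \<in> poly_cong f `` {u}" "v \<in> poly_cong f `` {v}"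
    by (auto simp: poly_cong_def)
  ultimately show "(poly_cong f `` {u}) \<rightarrow>\<^bsub>with_proj (gcd_graph f D)\<^esub> (poly_cong f `` {v})"
    by (auto simp: gcd_graph_def quotientI)
qed

lemma symmetric_gcd_graph: "symmetric (with_proj (gcd_graph f D))"
proof -
  have "gcd (u - v) f = gcd (v - u) f" for u v
    using gcd_neg1[of "v - u" f] by simp
  then show ?thesis
    unfolding symmetric_def sym_def gcd_graph_def by simp metis
qed

end

theory Submission
  imports Defs
begin

text \<open>
  The gcd-graph contains an induced cycle of length seven, and a graph with an odd hole is not
  perfect, because the hole needs three colours but has no triangle.

  To find the hole, fix distinct primes \<open>p\<close>, \<open>r\<close> dividing \<open>f1\<close> and a prime \<open>s\<close> dividing \<open>f2\<close>, and
  look at residues modulo these three only. If \<open>gcd d f = f1\<close>, then \<open>d\<close> vanishes modulo \<open>p\<close> and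
  \<open>r\<close> but not modulo \<open>s\<close>; if \<open>gcd d f = f2\<close>, it is the other way round. In terms of residues, every
  edge is therefore an edge of the Cartesian product of \<open>A \<times> B\<close> with \<open>C\<close>, where \<open>A\<close>, \<open>B\<close>, \<open>C\<close> are
  the complete graphs on the residue fields at \<open>p\<close>, \<open>r\<close>, \<open>s\<close> and \<open>\<times>\<close> is the direct product. This
  graph has an induced 7-cycle as soon as there is a constant \<open>t \<notin> {0, 1}\<close>: run through the
  closed walk \<open>(0,0), (1,t), (0,1), (1,0), (t,1), (0,0)\<close> of length five in \<open>A \<times> B\<close>, in the layer
  \<open>0\<close> of \<open>C\<close> for the first two steps and in the layer \<open>1\<close> for the other three, and change layers
  at the two points \<open>(0,1)\<close> and \<open>(0,0)\<close>. All chords are already excluded by the residues modulo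
  \<open>p\<close>, \<open>r\<close>, \<open>s\<close>.

  It remains to lift the seven points to polynomials so that along each side of the cycle the gcd
  is exactly \<open>f1\<close> or \<open>f2\<close>, in spite of repeated factors and of further primes of \<open>f\<close>. The lift is
  the linear combination \<open>combination\<close> of fixed polynomials with constant coefficients. Its
  summand \<open>smult c (f1 * f2)\<close> does this work: with the values of \<open>c\<close> forming a proper 3-colouring of
  the cycle, with colours \<open>0\<close>, \<open>1\<close>, \<open>t\<close>, the difference along a side is \<open>f1 * u\<close> or \<open>f2 * u\<close> with
  \<open>u\<close> coprime to \<open>f\<close>; see \<open>gcd_combination_eq_f1\<close>, \<open>gcd_combination_eq_f2\<close> and, for the chords,
  \<open>gcd_combination_imp\<close>.
\<close>

section \<open>Odd holes\<close>

text \<open>Without \<open>mod\<close>, adjacency in a cycle becomes accessible to linear arithmetic.\<close>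

lemma cyclic_neighbourD:
  fixes n :: nat
  assumes "i < n" "j < n" "j = Suc i mod n \<or> i = Suc j mod n"
  shows "j = Suc i \<or> i = Suc j \<or> i = 0 \<and> Suc j = n \<or> j = 0 \<and> Suc i = n"
proof -
  have "Suc m mod n = (if Suc m = n then 0 else Suc m)" if "m < n" for m
    using that by auto
  from this[OF assms(1)] this[OF assms(2)] assms(3) show ?thesis by metis
qed

text \<open>
  The easy half of the strong perfect graph theorem, for holes: the induced cycle has clique
  number at most two, while alternating two colours around an odd cycle fails at the last edge.
\<close>

lemma odd_hole_imp_not_perfect:
  fixes G :: "('v, 'e) pre_digraph" and v :: "nat \<Rightarrow> 'v"
  assumes "wf_digraph G" "odd n" "n \<ge> 5"
    and inj: "inj_on v {..<n}" and verts: "v ` {..<n} \<subseteq> verts G"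
    and adj: "\<And>i j. i < n \<Longrightarrow> j < n \<Longrightarrow>
               v i \<rightarrow>\<^bsub>G\<^esub> v j \<longleftrightarrow> j = Suc i mod n \<or> i = Suc j mod n"
  shows "\<not> perfect_graph G"
proof -
  define H where "H = G \<restriction> (v ` {..<n})"
  interpret wf_digraph G by fact
  have vH: "verts H = v ` {..<n}" by (simp add: H_def)
  have "induced_subgraph H G"
    unfolding H_def by (rule induced_induce[OF verts])
  have domH: "x \<rightarrow>\<^bsub>H\<^esub> y \<longleftrightarrow> x \<in> v ` {..<n} \<and> y \<in> v ` {..<n} \<and> x \<rightarrow>\<^bsub>G\<^esub> y" for x y
    by (force simp: H_def arcs_ends_conv image_iff)
  have adjH: "v i \<rightarrow>\<^bsub>H\<^esub> v j \<longleftrightarrow> j = Suc i mod n \<or> i = Suc j mod n"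
    if "i < n" "j < n" for i j
    using adj[OF that] that by (auto simp: domH)
  have no_triangle: False if "i < n" "j < n" "k < n" "i \<noteq> j" "j \<noteq> k" "i \<noteq> k"
      "j = Suc i mod n \<or> i = Suc j mod n"
      "k = Suc j mod n \<or> j = Suc k mod n"
      "k = Suc i mod n \<or> i = Suc k mod n" for i j k
  proof -
    note neighbours = that(7)[THEN cyclic_neighbourD[OF that(1,2)]]
      that(8)[THEN cyclic_neighbourD[OF that(2,3)]] that(9)[THEN cyclic_neighbourD[OF that(1,3)]]
    show False
      using that(1-3) \<open>n \<ge> 5\<close> that(4-6) neighbours by (elim disjE conjE) linarith+
  qed
  have card_le: "card K \<le> 2" if "is_clique H K" for K
  proof (rule ccontr)
    assume "\<not> card K \<le> 2"
    then have "3 \<le> card K" by simp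
    then obtain T where "T \<subseteq> K" "card T = 3" by (rule obtain_subset_with_card_n)
    then obtain x y z where T: "x \<in> K" "y \<in> K" "z \<in> K" "x \<noteq> y" "y \<noteq> z" "x \<noteq> z"
      by (auto simp: card_Suc_eq numeral_3_eq_3)
    moreover from that have "K \<subseteq> v ` {..<n}" by (simp add: is_clique_def vH)
    ultimately obtain i j k where ijk: "i < n" "j < n" "k < n" "x = v i" "y = v j" "z = v k"
      by (auto simp: subset_iff image_iff Ball_def) (metis lessThan_iff)
    have "v i \<rightarrow>\<^bsub>H\<^esub> v j" "v j \<rightarrow>\<^bsub>H\<^esub> v k" "v i \<rightarrow>\<^bsub>H\<^esub> v k"
      using that T ijk unfolding is_clique_def by blast+
    then have "j = Suc i mod n \<or> i = Suc j mod n" "k = Suc j mod n \<or> j = Suc k mod n"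
        "k = Suc i mod n \<or> i = Suc k mod n"
      using ijk by (simp_all only: adjH)
    moreover have "i \<noteq> j" "j \<noteq> k" "i \<noteq> k" using T ijk by blast+
    ultimately show False
      using no_triangle[of i j k] ijk by blast
  qed
  have "{K. is_clique H K} \<subseteq> Pow (v ` {..<n})"
    by (auto simp: is_clique_def vH)
  then have "finite {K. is_clique H K}"
    by (rule finite_subset) simp
  moreover have "is_clique H {}" by (simp add: is_clique_def)
  ultimately have "clique_number H \<le> 2"
    unfolding clique_number_def using card_le by (subst Max_le_iff) auto
  moreover have "2 < chromatic_number H"
  proof (rule ccontr)
    assume le: "\<not> 2 < chromatic_number H"
    \<comment> \<open>\<open>LEAST\<close> is meaningful only if some colouring exists; giving every vertex its own colour
      is one, as \<open>H\<close> has no loop.\<close>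
    have "proper_colouring H n (the_inv_into {..<n} v)"
      unfolding proper_colouring_def
    proof (intro conjI allI impI)
      show "the_inv_into {..<n} v ` verts H \<subseteq> {..<n}"
        using inj by (auto simp: vH the_inv_into_f_f)
      fix x y assume xy: "x \<rightarrow>\<^bsub>H\<^esub> y"
      then obtain i j where ij: "i < n" "j < n" "x = v i" "y = v j"
        by (auto simp: domH)
      then have "i \<noteq> j"
        using xy adjH[of i i] \<open>n \<ge> 5\<close> by (auto simp: mod_Suc split: if_splits)
      then show "the_inv_into {..<n} v x \<noteq> the_inv_into {..<n} v y"
        using ij inj by (simp add: the_inv_into_f_f)
    qed
    then have "\<exists>k c. proper_colouring H k c" by blast
    then have "\<exists>c. proper_colouring H (chromatic_number H) c"
      unfolding chromatic_number_def by (rule LeastI_ex)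
    then obtain c where c: "proper_colouring H (chromatic_number H) c" ..
    have c2: "c (v i) < 2" if "i < n" for i
      using c le that unfolding proper_colouring_def vH by force
    have step: "c (v i) \<noteq> c (v (Suc i mod n))" if "i < n" for i
      using c adjH[of i "Suc i mod n"] that unfolding proper_colouring_def by auto
    \<comment> \<open>With two colours the colour of \<open>v i\<close> is forced by the parity of \<open>i\<close>.\<close>
    have alternate: "c (v i) = c (v 0) \<longleftrightarrow> even i" if "i < n" for i
      using that
    proof (induction i)
      case (Suc i)
      then have "c (v i) \<noteq> c (v (Suc i))" using step[of i] by simp
      then show ?case
        using Suc c2[of i] c2[of "Suc i"] c2[of 0] by auto
    qed simp
    have "c (v (n - 1)) \<noteq> c (v 0)"
      using step[of "n - 1"] \<open>n \<ge> 5\<close> by simp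
    then show False
      using alternate[of "n - 1"] \<open>odd n\<close> \<open>n \<ge> 5\<close> by simp
  qed
  ultimately show ?thesis
    using \<open>induced_subgraph H G\<close> unfolding perfect_graph_def by fastforce
qed

lemma wf_digraph_gcd_graph: "wf_digraph (with_proj (gcd_graph f D))"
  by unfold_locales (auto simp: gcd_graph_def)


section \<open>Differences with prescribed divisibility\<close>

text \<open>
  A squarefree polynomial that separates the primes in \<open>S\<close> from the other primes of \<open>f\<close>: it takes
  the place of an idempotent from the Chinese remainder theorem, as only vanishing modulo
  primes, not an exact residue, matters below.
\<close>

definition prime_complement :: "'a :: field_gcd poly \<Rightarrow> 'a poly set \<Rightarrow> 'a poly" where
  "prime_complement f S = \<Prod>(prime_factors f - S)"

lemma dvd_prime_complement_iff:
  assumes "q \<in> prime_factors f"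
  shows "q dvd prime_complement f S \<longleftrightarrow> q \<notin> S"
proof
  assume "q dvd prime_complement f S"
  then obtain q' where "q' \<in> prime_factors f - S" "q dvd q'"
    using assms prime_dvd_prod_iff[of "prime_factors f - S" q "\<lambda>x. x"]
    by (auto simp: prime_complement_def)
  then show "q \<notin> S"
    using assms primes_dvd_imp_eq[of q q'] by auto
next
  assume "q \<notin> S"
  then show "q dvd prime_complement f S"
    using assms unfolding prime_complement_def by (intro dvd_prodI) auto
qed

lemma coprime_if_no_prime_factor_dvd:
  fixes f u :: "'a :: field_gcd poly"
  assumes "f \<noteq> 0" "\<And>q. q \<in> prime_factors f \<Longrightarrow> \<not> q dvd u"
  shows "coprime u f"
proof (rule ccontr)
  assume "\<not> coprime u f"
  then have "\<not> is_unit (gcd u f)" by (simp add: coprime_iff_gcd_eq_1)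
  moreover have "gcd u f \<noteq> 0" using assms(1) by simp
  ultimately obtain q where "prime q" "q dvd gcd u f"
    using prime_divisor_exists by blast
  then show False
    using assms by (auto simp: prime_factors_dvd)
qed

lemma gcd_mult_coprime_eq:
  fixes f g u :: "'a :: field_gcd poly"
  assumes "lead_coeff g = 1" "g dvd f" "coprime u f"
  shows "gcd (g * u) f = g"
proof -
  have "gcd (g * u) f = gcd g f"
    using assms(3) by (intro gcd_mult_left_right_cancel) (simp add: coprime_commute)
  also have "\<dots> = normalize g"
    using assms(2) by (rule gcd_proj1_if_dvd)
  also have "\<dots> = g"
    using assms(1) by (simp add: normalize_poly_def flip: one_pCons)
  finally show ?thesis .
qed

locale coprime_divisors =
  fixes f f1 f2 p r s :: "'a :: field_gcd poly"
  assumes f_nz: "f \<noteq> 0"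
    and monic1: "lead_coeff f1 = 1" and dvd1: "f1 dvd f"
    and monic2: "lead_coeff f2 = 1" and dvd2: "f2 dvd f"
    and cop: "coprime f1 f2"
    and p: "p \<in> prime_factors f1" and r: "r \<in> prime_factors f1" and pr: "p \<noteq> r"
    and s: "s \<in> prime_factors f2"
begin

text \<open>
  Modulo a prime of \<open>f1\<close>, only the first line survives: its value is a unit multiple of \<open>a\<close> at \<open>p\<close>
  and of \<open>b\<close> at all other primes of \<open>f1\<close>, among them \<open>r\<close>. Modulo a prime of \<open>f2\<close>, the value is a
  unit multiple of \<open>z\<close>. At the primes of \<open>f\<close> that divide neither \<open>f1\<close> nor \<open>f2\<close>, only \<open>c\<close> counts.
  The factors \<open>f2\<close>, \<open>f1\<close> and \<open>f1 * f2\<close> are there so that the combination is a multiple of \<open>f1\<close>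
  for \<open>a = b = 0\<close> and of \<open>f2\<close> for \<open>z = 0\<close>.
\<close>

definition combination :: "'a \<Rightarrow> 'a \<Rightarrow> 'a \<Rightarrow> 'a \<Rightarrow> 'a poly" where
  "combination a b z c =
     f2 * (smult a (prime_complement f {p}) + smult b (prime_complement f (prime_factors f1 - {p})))
     + f1 * smult z (prime_complement f (prime_factors f2))
     + smult c (f1 * f2)"

lemma combination_diff:
  "combination a b z c - combination a' b' z' c' = combination (a - a') (b - b') (z - z') (c - c')"
  by (simp add: combination_def smult_diff_left algebra_simps)

lemma nonzero_divisors: "f1 \<noteq> 0" "f2 \<noteq> 0"
  using monic1 monic2 by auto

lemma prime_factors_subset: "prime_factors f1 \<subseteq> prime_factors f" "prime_factors f2 \<subseteq> prime_factors f"
  using dvd1 dvd2 f_nz by (auto intro: dvd_prime_factors[THEN subsetD])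

lemma prime_factors_disjoint: "prime_factors f1 \<inter> prime_factors f2 = {}"
proof -
  have "\<not> q dvd f2" if "q \<in> prime_factors f1" for q
    using that coprime_common_divisor[OF cop, of q] not_prime_unit[of q]
    by (auto simp: in_prime_factors_iff)
  then show ?thesis by (auto dest: in_prime_factors_imp_dvd)
qed

lemma dvd_f1_iff: "q dvd f1 \<longleftrightarrow> q \<in> prime_factors f1" if "q \<in> prime_factors f"
  using that nonzero_divisors by (auto simp: prime_factors_dvd)

lemma dvd_f2_iff: "q dvd f2 \<longleftrightarrow> q \<in> prime_factors f2" if "q \<in> prime_factors f"
  using that nonzero_divisors by (auto simp: prime_factors_dvd)

lemma prime_factor_dvd_mult_iff: "q dvd a * b \<longleftrightarrow> q dvd a \<or> q dvd b" if "q \<in> prime_factors f"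
  using in_prime_factors_imp_prime[OF that] by (rule prime_dvd_mult_iff)

lemma p_dvd_combination_iff: "p dvd combination a b z c \<longleftrightarrow> a = 0"
proof -
  have P: "p \<in> prime_factors f" "p dvd f1" "\<not> p dvd f2"
    using p prime_factors_subset prime_factors_disjoint dvd_f2_iff by (auto simp: prime_factors_dvd)
  have "p dvd combination a b z c \<longleftrightarrow> p dvd f2 * smult a (prime_complement f {p})"
    unfolding combination_def using P dvd_prime_complement_iff[OF P(1)]
    by (simp add: distrib_left dvd_add_left_iff dvd_smult mult.assoc)
  also have "\<dots> \<longleftrightarrow> a = 0"
    using P dvd_prime_complement_iff[OF P(1)]
    by (cases "a = 0") (simp_all add: prime_factor_dvd_mult_iff dvd_smult_iff)
  finally show ?thesis .
qed

lemma r_dvd_combination_iff: "r dvd combination a b z c \<longleftrightarrow> b = 0"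
proof -
  have P: "r \<in> prime_factors f" "r dvd f1" "\<not> r dvd f2"
    using r prime_factors_subset prime_factors_disjoint dvd_f2_iff by (auto simp: prime_factors_dvd)
  have "r dvd combination a b z c \<longleftrightarrow>
          r dvd f2 * smult b (prime_complement f (prime_factors f1 - {p}))"
    unfolding combination_def using P pr dvd_prime_complement_iff[OF P(1)]
    by (simp add: distrib_left dvd_add_left_iff dvd_add_right_iff dvd_smult mult.assoc)
  also have "\<dots> \<longleftrightarrow> b = 0"
    using P r pr dvd_prime_complement_iff[OF P(1)]
    by (cases "b = 0") (simp_all add: prime_factor_dvd_mult_iff dvd_smult_iff)
  finally show ?thesis .
qed

lemma s_dvd_combination_iff: "s dvd combination a b z c \<longleftrightarrow> z = 0"
proof -
  have P: "s \<in> prime_factors f" "s dvd f2" "\<not> s dvd f1"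
    using s prime_factors_subset prime_factors_disjoint dvd_f1_iff by (auto simp: prime_factors_dvd)
  have "s dvd combination a b z c \<longleftrightarrow> s dvd f1 * smult z (prime_complement f (prime_factors f2))"
    unfolding combination_def using P
    by (simp add: dvd_add_left_iff dvd_add_right_iff dvd_smult)
  also have "\<dots> \<longleftrightarrow> z = 0"
    using P s dvd_prime_complement_iff[OF P(1)]
    by (cases "z = 0") (simp_all add: prime_factor_dvd_mult_iff dvd_smult_iff)
  finally show ?thesis .
qed

text \<open>
  The cofactor of \<open>f1\<close> is a sum whose two summands have no prime of \<open>f\<close> in common, but together
  involve all of them; hence it is coprime to \<open>f\<close>, whatever the multiplicities in \<open>f1\<close> and \<open>f\<close>.
\<close>

lemma gcd_combination_eq_f1:
  assumes "z \<noteq> 0" "c \<noteq> 0"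
  shows "gcd (combination 0 0 z c) f = f1"
proof -
  define u where "u = smult z (prime_complement f (prime_factors f2)) + smult c f2"
  have "combination 0 0 z c = f1 * u"
    by (simp add: combination_def u_def distrib_left mult.commute)
  moreover have "coprime u f"
  proof (rule coprime_if_no_prime_factor_dvd[OF f_nz])
    fix q assume q: "q \<in> prime_factors f"
    show "\<not> q dvd u"
      using assms dvd_prime_complement_iff[OF q] dvd_f2_iff[OF q]
      by (cases "q dvd f2")
         (simp_all add: u_def dvd_smult_iff dvd_add_left_iff dvd_add_right_iff)
  qed
  ultimately show ?thesis
    using monic1 dvd1 by (simp add: gcd_mult_coprime_eq)
qed

text \<open>
  Now the cofactor has three summands, each of them being the one that is not divisible by a prime
  \<open>q\<close> of \<open>f\<close> in one of three cases: \<open>q = p\<close>, \<open>q\<close> another prime of \<open>f1\<close>, and \<open>q\<close> not dividing \<open>f1\<close>.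
\<close>

lemma gcd_combination_eq_f2:
  assumes "a \<noteq> 0" "b \<noteq> 0" "c \<noteq> 0"
  shows "gcd (combination a b 0 c) f = f2"
proof -
  define u where "u = smult a (prime_complement f {p})
    + smult b (prime_complement f (prime_factors f1 - {p})) + smult c f1"
  have "combination a b 0 c = f2 * u"
    by (simp add: combination_def u_def distrib_left mult.commute)
  moreover have "coprime u f"
  proof (rule coprime_if_no_prime_factor_dvd[OF f_nz])
    fix q assume q: "q \<in> prime_factors f"
    have dvd_iffs: "q dvd prime_complement f {p} \<longleftrightarrow> q \<noteq> p"
      "q dvd prime_complement f (prime_factors f1 - {p}) \<longleftrightarrow> q \<notin> prime_factors f1 \<or> q = p"
      "q dvd f1 \<longleftrightarrow> q \<in> prime_factors f1"
      using dvd_prime_complement_iff[OF q] dvd_f1_iff[OF q] by auto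
    consider "q = p" "q \<in> prime_factors f1" | "q \<noteq> p" "q \<in> prime_factors f1"
      | "q \<noteq> p" "q \<notin> prime_factors f1"
      using p by blast
    then show "\<not> q dvd u"
    proof cases
      case 1
      with dvd_iffs have "q dvd smult b (prime_complement f (prime_factors f1 - {p}))"
        "q dvd smult c f1" "\<not> q dvd smult a (prime_complement f {p})"
        using assms by (simp_all only: dvd_smult_iff simp_thms)
      then show ?thesis by (simp only: u_def dvd_add_left_iff simp_thms)
    next
      case 2
      with dvd_iffs have "\<not> q dvd smult b (prime_complement f (prime_factors f1 - {p}))"
        "q dvd smult c f1" "q dvd smult a (prime_complement f {p})"
        using assms by (simp_all only: dvd_smult_iff simp_thms)
      then show ?thesis by (simp only: u_def dvd_add_left_iff dvd_add_right_iff simp_thms)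
    next
      case 3
      with dvd_iffs have "q dvd smult b (prime_complement f (prime_factors f1 - {p}))"
        "\<not> q dvd smult c f1" "q dvd smult a (prime_complement f {p})"
        using assms by (simp_all only: dvd_smult_iff simp_thms)
      then show ?thesis by (simp only: u_def dvd_add dvd_add_right_iff simp_thms)
    qed
  qed
  ultimately show ?thesis
    using monic2 dvd2 by (simp add: gcd_mult_coprime_eq)
qed

text \<open>
  This excludes the chords: divisibility of the gcd by \<open>p\<close>, \<open>r\<close> and \<open>s\<close> shows which coefficients
  vanish, and \<open>p\<close>, \<open>r\<close> divide \<open>f1\<close> but not \<open>f2\<close>, whereas \<open>s\<close> divides \<open>f2\<close> but not \<open>f1\<close>.
\<close>

lemma gcd_combination_imp:
  assumes "gcd (combination a b z c) f \<in> {f1, f2}"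
  shows "a = 0 \<and> b = 0 \<and> z \<noteq> 0 \<or> a \<noteq> 0 \<and> b \<noteq> 0 \<and> z = 0"
proof -
  define G where "G = gcd (combination a b z c) f"
  have in_f: "p \<in> prime_factors f" "r \<in> prime_factors f" "s \<in> prime_factors f"
    using p r s prime_factors_subset by auto
  have outside: "p \<notin> prime_factors f2" "r \<notin> prime_factors f2" "s \<notin> prime_factors f1"
    using p r s prime_factors_disjoint by auto
  have "p dvd G \<longleftrightarrow> a = 0" "r dvd G \<longleftrightarrow> b = 0" "s dvd G \<longleftrightarrow> z = 0"
    using in_f
    by (auto simp: G_def p_dvd_combination_iff r_dvd_combination_iff s_dvd_combination_iff)
  moreover have "G = f1 \<or> G = f2" using assms by (simp add: G_def)
  ultimately show ?thesis
    using p r s outside in_f[THEN dvd_f1_iff] in_f[THEN dvd_f2_iff] by auto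
qed

lemma combination_eq_zero_if_dvd:
  assumes "f dvd combination a b z c"
  shows "a = 0" "b = 0" "z = 0"
proof -
  have "q dvd combination a b z c" if "q \<in> prime_factors f1 \<union> prime_factors f2" for q
    using that prime_factors_subset assms by (blast intro: dvd_trans in_prime_factors_imp_dvd)
  with p r s show "a = 0" "b = 0" "z = 0"
    by (simp_all flip: p_dvd_combination_iff[of a b z c] r_dvd_combination_iff[of a b z c]
          s_dvd_combination_iff[of a b z c])
qed


section \<open>The seven-cycle\<close>

text \<open>
  A sequence of seven coordinate vectors whose differences have the pattern permitted by
  \<open>gcd_combination_imp\<close> exactly for cyclic neighbours. The walk of length five in the coordinates
  at \<open>p\<close> and \<open>r\<close> alone has the chord from \<open>(1,t)\<close> to \<open>(t,1)\<close>; the changes of layer put its ends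
  into different layers, where all three coordinates differ and no edge is left.
\<close>

lemma seven_hole:
  fixes t :: 'a
  assumes t: "t \<noteq> 0" "t \<noteq> 1"
  shows "\<not> perfect_graph (with_proj (gcd_graph f {f1, f2}))"
proof -
  \<comment> \<open>\<open>X\<close>, \<open>Y\<close>, \<open>Z\<close> govern the residues at \<open>p\<close>, \<open>r\<close>, \<open>s\<close>; \<open>C\<close> is a proper 3-colouring of the cycle.\<close>
  define X where "X = (!) [0, 1, 0, 0, 1, t, 0]"
  define Y where "Y = (!) [0, t, 1, 1, 0, 1, 0]"
  define Z :: "nat \<Rightarrow> 'a" where "Z = (!) [0, 0, 0, 1, 1, 1, 1]"
  define C where "C = (!) [0, 1, 0, 1, 0, 1, t]"
  define w where "w i = combination (X i) (Y i) (Z i) (C i)" for i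
  define v where "v i = poly_cong f `` {w i}" for i
  note defs = X_def Y_def Z_def C_def
  have seven: "i < 7 \<longleftrightarrow> i = 0 \<or> i = 1 \<or> i = 2 \<or> i = 3 \<or> i = 4 \<or> i = 5 \<or> i = 6" for i :: nat
    by auto
  have diff: "w i - w j = combination (X i - X j) (Y i - Y j) (Z i - Z j) (C i - C j)" for i j
    by (simp add: w_def combination_diff)
  have pattern: "X i = X j \<and> Y i = Y j \<and> Z i \<noteq> Z j \<or> X i \<noteq> X j \<and> Y i \<noteq> Y j \<and> Z i = Z j
      \<longleftrightarrow> j = Suc i mod 7 \<or> i = Suc j mod 7" if "i < 7" "j < 7" for i j
    using that t t[symmetric] unfolding seven by (elim disjE) (simp_all add: defs)
  have colouring: "C i \<noteq> C j" if "i < 7" "j < 7" "j = Suc i mod 7 \<or> i = Suc j mod 7" for i j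
    using that t t[symmetric] unfolding seven by (elim disjE) (simp_all add: defs)
  have distinct: "i = j" if "i < 7" "j < 7" "X i = X j" "Y i = Y j" "Z i = Z j" for i j
    using that t t[symmetric] unfolding seven by (elim disjE) (simp_all add: defs)
  show ?thesis
  proof (rule odd_hole_imp_not_perfect[OF wf_digraph_gcd_graph, of 7 v])
    show "inj_on v {..<7}"
    proof (rule inj_onI)
      fix i j :: nat assume ij: "i \<in> {..<7}" "j \<in> {..<7}" "v i = v j"
      then have "f dvd w i - w j"
        using eq_equiv_class[OF _ equiv_poly_cong] by (auto simp: v_def poly_cong_def)
      then show "i = j"
        using combination_eq_zero_if_dvd[of "X i - X j" "Y i - Y j" "Z i - Z j" "C i - C j"]
          ij distinct[of i j] by (simp add: diff)
    qed
    show "v ` {..<7} \<subseteq> verts (with_proj (gcd_graph f {f1, f2}))"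
      by (auto simp: v_def gcd_graph_def intro: quotientI)
    fix i j :: nat assume ij: "i < 7" "j < 7"
    have "gcd (w i - w j) f \<in> {f1, f2} \<longleftrightarrow> j = Suc i mod 7 \<or> i = Suc j mod 7"
    proof
      assume "gcd (w i - w j) f \<in> {f1, f2}"
      from gcd_combination_imp[OF this[unfolded diff]] pattern[OF ij]
      show "j = Suc i mod 7 \<or> i = Suc j mod 7" by simp
    next
      assume *: "j = Suc i mod 7 \<or> i = Suc j mod 7"
      with pattern[OF ij] colouring[OF ij *]
      show "gcd (w i - w j) f \<in> {f1, f2}"
        using gcd_combination_eq_f1[of "Z i - Z j" "C i - C j"]
          gcd_combination_eq_f2[of "X i - X j" "Y i - Y j" "C i - C j"]
        unfolding diff by auto
    qed
    then show "v i \<rightarrow>\<^bsub>with_proj (gcd_graph f {f1, f2})\<^esub> v j \<longleftrightarrow> j = Suc i mod 7 \<or> i = Suc j mod 7"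
      by (simp only: v_def gcd_graph_adj_iff)
  qed simp_all
qed

end

text \<open>In a polynomial ring over a field, the normalized elements other than \<open>0\<close> are the monic ones.\<close>

lemma omega_eq_card_prime_factors:
  fixes h :: "'a :: field_gcd poly"
  assumes "h \<noteq> 0"
  shows "omega h = card (prime_factors h)"
proof -
  have "lead_coeff q = 1 \<and> irreducible q \<longleftrightarrow> prime q" for q :: "'a poly"
  proof
    assume "lead_coeff q = 1 \<and> irreducible q"
    then show "prime q"
      by (auto intro!: primeI irreducible_imp_prime_elem simp: normalize_poly_def simp flip: one_pCons)
  next
    assume "prime q"
    then have "q \<noteq> 0" "normalize q = q" by auto
    then have "unit_factor q = 1" by (metis unit_factor_normalize)
    moreover have "unit_factor (lead_coeff q) = lead_coeff q"
      using \<open>q \<noteq> 0\<close> by (intro is_unit_unit_factor) (simp add: dvd_field_iff)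
    ultimately have "lead_coeff q = 1" by (simp add: unit_factor_poly_def one_pCons)
    then show "lead_coeff q = 1 \<and> irreducible q"
      using \<open>prime q\<close> by (simp add: prime_elem_imp_irreducible)
  qed
  then have "{q. lead_coeff q = 1 \<and> irreducible q \<and> q dvd h} = prime_factors h"
    using assms by (auto simp: prime_factors_dvd)
  then show ?thesis by (simp add: omega_def)
qed

theorem proposition7p5:
  fixes f f1 f2 :: "'a :: {field_gcd, finite} poly" and D :: "'a poly set"
  assumes "f \<noteq> 0" and "lead_coeff f = 1"
    and "D = {f1, f2}"
    and "lead_coeff f1 = 1" and "f1 dvd f"
    and "lead_coeff f2 = 1" and "f2 dvd f"
    and "gcd f1 f2 = 1"
    and "card (UNIV :: 'a set) \<noteq> 2"
    and "omega f1 \<ge> 2" and "omega f2 \<ge> 1"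
  shows "\<not> perfect_graph (with_proj (gcd_graph f D))"
proof -
  have nz: "f1 \<noteq> 0" "f2 \<noteq> 0" using assms(4,6) by auto
  obtain p r where pr: "p \<in> prime_factors f1" "r \<in> prime_factors f1" "p \<noteq> r"
    using assms(10) card_le_Suc0_iff_eq[of "prime_factors f1"]
    by (auto simp: omega_eq_card_prime_factors[OF nz(1)])
  obtain s where s: "s \<in> prime_factors f2"
    using assms(11) by (fastforce simp: omega_eq_card_prime_factors[OF nz(2)])
  interpret coprime_divisors f f1 f2 p r s
    using assms pr s by unfold_locales (auto simp: coprime_iff_gcd_eq_1)
  have "\<exists>t :: 'a. t \<noteq> 0 \<and> t \<noteq> 1"
  proof (rule ccontr)
    assume "\<nexists>t :: 'a. t \<noteq> 0 \<and> t \<noteq> 1"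
    then have "UNIV = {0, 1 :: 'a}" by auto
    then have "card (UNIV :: 'a set) = card {0, 1 :: 'a}" by (rule arg_cong)
    then show False using assms(9) by simp
  qed
  then show ?thesis
    using seven_hole assms(3) by blast
qed

end
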